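(* Consider any monotone generalized alpha investing rule with parameters $w_0\ge 0$, $b_0>0$ satisfying $w_0+b_0\le\alpha$. Assume that, under every $\mathbb{P}_{\boldsymbol\theta}$, $\boldsymbol\theta\in\boldsymbol\Theta$, the $p$-values $(p_i)_{i\in\mathbb{N}}$ are independent. Then $$\sup_{n\ge 1}\,\mathrm{FDR}(n)\le \alpha .$$ The same conclusion holds if only the $p$-values corresponding to true null hypotheses are mutually independent and independent from the $p$-values corresponding to non-null hypotheses.
   Context: Setting. $\mathbb{N}=\{1,2,\dots\}$. There is a sequence of null hypotheses $(H_i)_{i\in\mathbb{N}}$ with $H_i=\{\theta_i=0\}$, where $\theta_i$ belongs to a set $\Theta$ of possible parameter values and $\boldsymbol\theta=(\theta_i)_{i\in\mathbb{N}}\in\boldsymbol\Theta=\Theta^{\mathbb{N}}$. For each $\boldsymbol\theta$, $\mathbb{P}_{\boldsymbol\theta}$ (expectation $\mathbb{E}_{\boldsymbol\theta}$) is the law of the $[0,1]$-valued $p$-values $(p_i)_{i\in\mathbb{N}}$; if $\theta_i=0$ (true null) then $p_i$ is uniform on $[0,1]$ under $\mathbb{P}_{\boldsymbol\theta}$. Generalized alpha investing rule. A generalized alpha investing rule with parameters $w_0\ge0$, $b_0>0$ is given by functions $\alpha_j,\varphi_j,\psi_j:\{0,1\}^{j-1}\to[0,\infty)$, $j\in\mathbb{N}$. Decisions are $R_j=1$ (reject $H_j$) if $p_j\le\alpha_j(R_1,\dots,R_{j-1})$ and $R_j=0$ otherwise. The potential is $W(0)=w_0$, $W(j)=W(j-1)-\varphi_j(R_1,\dots,R_{j-1})+R_j\,\psi_j(R_1,\dots,R_{j-1})$,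 viewed as a function of $(R_1,\dots,R_j)\in\{0,1\}^j$. It is required that, for all $j\in\mathbb{N}$ and all $(R_1,\dots,R_{j-1})\in\{0,1\}^{j-1}$ (evaluating $\alpha_j,\varphi_j,\psi_j$ at this history): (G1) $\psi_j\le\varphi_j+b_0$; $\ \psi_j\le \varphi_j/\alpha_j+b_0-1$ (with $\varphi_j/\alpha_j:=+\infty$ when $\alpha_j=0$); and $\varphi_j\le W(j-1)$. (G2) if $W(j-1)=0$ then $\alpha_j=0$. Monotone. The rule is monotone if for every $j$ and all $\boldsymbol x,\boldsymbol y\in\{0,1\}^{j-1}$ with $x_i\le y_i$ for all $i$, one has $\alpha_j(\boldsymbol x)\le\alpha_j(\boldsymbol y)$. FDR. $R(n)=\sum_{i=1}^n R_i$, $V^{\boldsymbol\theta}(n)=\#\{i\le n: R_i=1,\ \theta_i=0\}$, $a\vee b=\max(a,b)$, and $$\mathrm{FDR}(n)=\sup_{\boldsymbol\theta\in\boldsymbol\Theta}\mathbb{E}_{\boldsymbol\theta}\Big[\frac{V^{\boldsymbol\theta}(n)}{R(n)\vee 1}\Big].$$ *)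

theory Defs
  imports "HOL-Probability.Probability"
begin

text \<open>
  Decisions are Booleans, with \<open>True\<close> for 1 (rejection) and \<open>False\<close> for 0; a vector
  \<open>(R\<^sub>1, \<dots>, R\<^sub>j)\<close> in \<open>{0,1}\<^sup>j\<close> is the list \<open>[R\<^sub>1, \<dots>, R\<^sub>j]\<close> in chronological order.
  Functions \<open>\<alpha>\<^sub>j, \<phi>\<^sub>j, \<psi>\<^sub>j\<close> on \<open>{0,1}\<^sup>j\<^sup>-\<^sup>1\<close> are given as \<open>nat \<Rightarrow> bool list \<Rightarrow> real\<close>; their values are
  constrained and used only for \<open>j \<ge> 1\<close> and lists of length \<open>j - 1\<close>.
\<close>

type_synonym history_fun = "nat \<Rightarrow> bool list \<Rightarrow> real"

text \<open>
  \<open>potential w0 \<phi> \<psi> j x\<close> is \<open>W(j)\<close> at \<open>x = [R\<^sub>1, \<dots>, R\<^sub>j]\<close>. Lists are indexed from 0, so \<open>x ! j\<close>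
  is \<open>R\<^sub>j\<^sub>+\<^sub>1\<close>. Entries of \<open>x\<close> beyond the \<open>j\<close>-th are ignored.
\<close>

primrec potential :: "real \<Rightarrow> history_fun \<Rightarrow> history_fun \<Rightarrow> nat \<Rightarrow> bool list \<Rightarrow> real" where
  "potential w0 \<phi> \<psi> 0 x = w0"
| "potential w0 \<phi> \<psi> (Suc j) x =
     potential w0 \<phi> \<psi> j x - \<phi> (Suc j) (take j x) + of_bool (x ! j) * \<psi> (Suc j) (take j x)"

text \<open>
  The premise \<open>\<alpha> j x \<noteq> 0\<close> below implements the convention \<open>\<phi>\<^sub>j / \<alpha>\<^sub>j = \<infinity>\<close> for \<open>\<alpha>\<^sub>j = 0\<close>
  (in HOL the quotient would be 0).
\<close>

definition gai_rule ::
  "real \<Rightarrow> real \<Rightarrow> history_fun \<Rightarrow> history_fun \<Rightarrow> history_fun \<Rightarrow> bool" where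
  "gai_rule w0 b0 \<alpha> \<phi> \<psi> \<longleftrightarrow>
     0 \<le> w0 \<and> 0 < b0 \<and>
     (\<forall>j\<ge>1. \<forall>x. length x = j - 1 \<longrightarrow>
        0 \<le> \<alpha> j x \<and> 0 \<le> \<phi> j x \<and> 0 \<le> \<psi> j x \<and>
        \<psi> j x \<le> \<phi> j x + b0 \<and>
        (\<alpha> j x \<noteq> 0 \<longrightarrow> \<psi> j x \<le> \<phi> j x / \<alpha> j x + b0 - 1) \<and>
        \<phi> j x \<le> potential w0 \<phi> \<psi> (j - 1) x \<and>
        (potential w0 \<phi> \<psi> (j - 1) x = 0 \<longrightarrow> \<alpha> j x = 0))"

definition monotone_rule :: "history_fun \<Rightarrow> bool" where
  "monotone_rule \<alpha> \<longleftrightarrow>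
     (\<forall>j\<ge>1. \<forall>x y. length x = j - 1 \<longrightarrow> length y = j - 1 \<longrightarrow>
        (\<forall>i < j - 1. x ! i \<le> y ! i) \<longrightarrow> \<alpha> j x \<le> \<alpha> j y)"

text \<open>
  For a sequence \<open>q\<close> of p-values, \<open>history \<alpha> q n\<close> is \<open>[R\<^sub>1, \<dots>, R\<^sub>n]\<close> and \<open>rejects \<alpha> q j\<close> is \<open>R\<^sub>j\<close>.
\<close>

primrec history :: "history_fun \<Rightarrow> (nat \<Rightarrow> real) \<Rightarrow> nat \<Rightarrow> bool list" where
  "history \<alpha> q 0 = []"
| "history \<alpha> q (Suc n) = history \<alpha> q n @ [q (Suc n) \<le> \<alpha> (Suc n) (history \<alpha> q n)]"

definition rejects :: "history_fun \<Rightarrow> (nat \<Rightarrow> real) \<Rightarrow> nat \<Rightarrow> bool" where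
  "rejects \<alpha> q j \<longleftrightarrow> q j \<le> \<alpha> j (history \<alpha> q (j - 1))"

definition discoveries :: "history_fun \<Rightarrow> (nat \<Rightarrow> real) \<Rightarrow> nat \<Rightarrow> nat" where
  "discoveries \<alpha> q n = card {i \<in> {1..n}. rejects \<alpha> q i}"

definition false_discoveries ::
  "history_fun \<Rightarrow> (nat \<Rightarrow> 't::zero) \<Rightarrow> (nat \<Rightarrow> real) \<Rightarrow> nat \<Rightarrow> nat" where
  "false_discoveries \<alpha> \<theta> q n = card {i \<in> {1..n}. rejects \<alpha> q i \<and> \<theta> i = 0}"

text \<open>
  \<open>params \<Theta>\<close> is \<open>\<Theta>\<^sup>\<nat>\<close> with \<open>\<nat> = {1, 2, \<dots>}\<close>, as extensional functions, so that the
  irrelevant coordinate 0 carries no information.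
\<close>

definition params :: "'t set \<Rightarrow> (nat \<Rightarrow> 't) set" where
  "params \<Theta> = ({1..} \<rightarrow>\<^sub>E \<Theta>)"

text \<open>
  The p-values are random variables \<open>p i\<close>, \<open>i \<ge> 1\<close>, on a space carrying a probability measure
  \<open>P \<theta>\<close> for every \<open>\<theta>\<close>. The canonical model, \<open>P \<theta>\<close> being the law of the sequence and
  \<open>p i\<close> the \<open>i\<close>-th coordinate, is a special case.
\<close>

definition pvalue_model ::
  "'t::zero set \<Rightarrow> ((nat \<Rightarrow> 't) \<Rightarrow> 'w measure) \<Rightarrow> (nat \<Rightarrow> 'w \<Rightarrow> real) \<Rightarrow> bool" where
  "pvalue_model \<Theta> P p \<longleftrightarrow>
     (\<forall>\<theta>\<in>params \<Theta>. prob_space (P \<theta>) \<and>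
        (\<forall>i\<ge>1. p i \<in> borel_measurable (P \<theta>) \<and>
               (\<forall>\<omega>\<in>space (P \<theta>). p i \<omega> \<in> {0..1}) \<and>
               (\<theta> i = 0 \<longrightarrow> distr (P \<theta>) lborel (p i) = uniform_measure lborel {0..1})))"

definition indep_pvalues :: "'w measure \<Rightarrow> (nat \<Rightarrow> 'w \<Rightarrow> real) \<Rightarrow> bool" where
  "indep_pvalues M p \<longleftrightarrow> prob_space.indep_vars M (\<lambda>_. borel) p {1..}"

definition indep_null_pvalues ::
  "(nat \<Rightarrow> 't::zero) \<Rightarrow> 'w measure \<Rightarrow> (nat \<Rightarrow> 'w \<Rightarrow> real) \<Rightarrow> bool" where
  "indep_null_pvalues \<theta> M p \<longleftrightarrow>
     (let N0 = {i. 1 \<le> i \<and> \<theta> i = 0}; N1 = {i. 1 \<le> i \<and> \<theta> i \<noteq> 0} in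
        prob_space.indep_vars M (\<lambda>_. borel) p N0 \<and>
        prob_space.indep_var M
          (\<Pi>\<^sub>M i\<in>N0. borel) (\<lambda>\<omega>. \<lambda>i\<in>N0. p i \<omega>)
          (\<Pi>\<^sub>M i\<in>N1. borel) (\<lambda>\<omega>. \<lambda>i\<in>N1. p i \<omega>))"

text \<open>
  The supremum is taken in the extended reals, where it exists without side conditions
  (also for empty \<open>\<Theta>\<close>).
\<close>

definition FDR ::
  "'t::zero set \<Rightarrow> ((nat \<Rightarrow> 't) \<Rightarrow> 'w measure) \<Rightarrow> (nat \<Rightarrow> 'w \<Rightarrow> real) \<Rightarrow> history_fun \<Rightarrow> nat \<Rightarrow> ereal" where
  "FDR \<Theta> P p \<alpha> n =
     (SUP \<theta>\<in>params \<Theta>. ereal (\<integral>\<omega>. real (false_discoveries \<alpha> \<theta> (\<lambda>i. p i \<omega>) n)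
                                    / real (max (discoveries \<alpha> (\<lambda>i. p i \<omega>) n) 1) \<partial>(P \<theta>)))"

end

theory Submission
  imports Defs
begin

text \<open>
  Write \<open>N = max R(n) 1\<close>. The proof compares \<open>V(n)\<close> with \<open>b0 R(n) + w0 - W(n)\<close>. This quantity is at
  most \<open>(b0 + w0) N\<close>, because the potential \<open>W(n)\<close> stays nonnegative; so it is enough that
  \<open>E[(b0 R(n) - V(n) + w0 - W(n)) / N] \<ge> 0\<close>. The numerator is a sum over the tests \<open>i = 1, \<dots>, n\<close> of
  increments \<open>b0 R\<^sub>i - [\<theta>\<^sub>i = 0] R\<^sub>i + \<phi>\<^sub>i - R\<^sub>i \<psi>\<^sub>i\<close>, and each of them contributes a nonnegative amount.

  For a non-null \<open>i\<close> the increment is nonnegative pointwise, by \<open>\<psi>\<^sub>i \<le> \<phi>\<^sub>i + b0\<close>. For a null \<open>i\<close> it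
  is \<open>\<phi>\<^sub>i - R\<^sub>i (\<psi>\<^sub>i + 1 - b0)\<close>, where the second constraint on the payout says that
  \<open>\<alpha>\<^sub>i (\<psi>\<^sub>i + 1 - b0) \<le> \<phi>\<^sub>i\<close>. If \<open>N\<close> were absent, one would replace \<open>R\<^sub>i\<close> by its conditional
  expectation, which is at most \<open>\<alpha>\<^sub>i\<close>. But \<open>N\<close> depends on \<open>R\<^sub>i\<close>, both directly and through the levels
  of all later tests. Monotonicity of the rule is what makes the replacement possible anyway
  (\<open>null_rejection_le_threshold\<close>): replace \<open>p\<^sub>i\<close> by \<open>0\<close>, which forces a rejection of \<open>H\<^sub>i\<close>, and
  let \<open>N'\<close> be the resulting value of \<open>N\<close>. On \<open>R\<^sub>i = 1\<close> nothing has changed, so \<open>R\<^sub>i / N = R\<^sub>i / N'\<close>;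
  now \<open>N'\<close> and the history before \<open>i\<close> do not involve \<open>p\<^sub>i\<close>, so independence turns \<open>R\<^sub>i\<close> into at most
  \<open>\<alpha>\<^sub>i\<close>; and finally \<open>1 / N' \<le> 1 / N\<close>, because smaller p-values can only produce more rejections.

  The argument uses that a null p-value is independent of all the others. This is what the second
  independence assumption says, and the first one implies it.
\<close>

section \<open>Histories of decisions\<close>

lemma length_history [simp]: "length (history \<alpha> q n) = n"
  by (induction n) auto

lemma take_history: "m \<le> n \<Longrightarrow> take m (history \<alpha> q n) = history \<alpha> q m"
  by (induction n) (auto simp: le_Suc_eq)

lemma nth_history: "i < n \<Longrightarrow> history \<alpha> q n ! i = rejects \<alpha> q (Suc i)"
  by (induction n) (auto simp: nth_append less_Suc_eq rejects_def)

text \<open>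
  Once the whole vector of decisions is prescribed, the levels are constants and each decision
  constrains one p-value only. Hence the event of observing a given history is a product event,
  and elementary independence of events suffices later on.
\<close>

lemma history_eq_iff:
  "history \<alpha> q n = x \<longleftrightarrow>
     length x = n \<and> (\<forall>i\<in>{1..n}. (q i \<le> \<alpha> i (take (i - 1) x)) = x ! (i - 1))"
proof (induction n arbitrary: x)
  case 0
  then show ?case by auto
next
  case (Suc n)
  show ?case
  proof (cases x rule: rev_cases)
    case Nil
    then show ?thesis by auto
  next
    case (snoc y b)
    show ?thesis
    proof (cases "length y = n")
      case True
      have "take (i - 1) x = take (i - 1) y \<and> x ! (i - 1) = y ! (i - 1)" if "i \<in> {1..n}" for i
        using that True by (auto simp: snoc nth_append)
      moreover have "take n x = y \<and> x ! n = b"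
        using True by (auto simp: snoc nth_append)
      ultimately have "(\<forall>i\<in>{1..Suc n}. (q i \<le> \<alpha> i (take (i - 1) x)) = x ! (i - 1)) \<longleftrightarrow>
            history \<alpha> q n = y \<and> (q (Suc n) \<le> \<alpha> (Suc n) y) = b"
        using True Suc.IH[of y] by (simp add: atLeastAtMostSuc_conv conj_commute)
      moreover have "history \<alpha> q (Suc n) = x \<longleftrightarrow>
            history \<alpha> q n = y \<and> (q (Suc n) \<le> \<alpha> (Suc n) y) = b"
        by (auto simp: snoc)
      moreover have "length x = Suc n"
        using True by (simp add: snoc)
      ultimately show ?thesis by blast
    next
      case False
      then have "length x \<noteq> Suc n"
        by (simp add: snoc)
      then show ?thesis by (metis length_history)
    qed
  qed
qed

lemma discoveries_history:
  "discoveries \<alpha> q n = card {i \<in> {1..n}. history \<alpha> q n ! (i - 1)}"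
proof -
  have "rejects \<alpha> q i = history \<alpha> q n ! (i - 1)" if "i \<in> {1..n}" for i
    using that by (subst nth_history) auto
  then show ?thesis
    unfolding discoveries_def by (metis (mono_tags, lifting))
qed

text \<open>
  Lowering p-values is self-reinforcing under a monotone rule: the rejections gained so far raise
  the later levels, so that no rejection is ever lost.
\<close>

lemma history_mono:
  assumes "monotone_rule \<alpha>" and "\<And>i. i \<in> {1..n} \<Longrightarrow> q' i \<le> q i"
    and "i < n" "history \<alpha> q n ! i"
  shows "history \<alpha> q' n ! i"
  using assms(2-)
proof (induction n arbitrary: i)
  case (Suc n)
  have IH: "history \<alpha> q n ! k \<le> history \<alpha> q' n ! k" if "k < n" for k
    using Suc.IH[of k] Suc.prems(1) that by auto
  then have "\<alpha> (Suc n) (history \<alpha> q n) \<le> \<alpha> (Suc n) (history \<alpha> q' n)"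
    using assms(1) unfolding monotone_rule_def by auto
  moreover have "q' (Suc n) \<le> q (Suc n)" using Suc.prems(1) by auto
  ultimately show ?case
    using Suc.prems(2,3) IH[of i] by (auto simp: nth_append split: if_splits)
qed auto

lemma discoveries_mono:
  assumes "monotone_rule \<alpha>" and "\<And>i. i \<in> {1..n} \<Longrightarrow> q' i \<le> q i"
  shows "discoveries \<alpha> q n \<le> discoveries \<alpha> q' n"
  unfolding discoveries_history
  by (rule card_mono) (auto intro!: history_mono[OF assms])

text \<open>
  The process depends on a p-value only through the decision taken on it, and \<open>0\<close> is rejected at
  every nonnegative level.
\<close>

lemma history_upd_rejected:
  assumes "rejects \<alpha> q j" "0 \<le> \<alpha> j (history \<alpha> q (j - 1))"
  shows "history \<alpha> (q(j := 0)) n = history \<alpha> q n"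
  using assms by (induction n) (auto simp: rejects_def)

lemma history_upd_before: "m < j \<Longrightarrow> history \<alpha> (q(j := c)) m = history \<alpha> q m"
  by (induction m) auto

section \<open>The potential along a history\<close>

text \<open>
  The bound \<open>m \<le> n\<close> allows the potential at an earlier time to be read off a longer history.
\<close>

lemma potential_history:
  "m \<le> n \<Longrightarrow> potential w0 \<phi> \<psi> m (history \<alpha> q n) =
     w0 + (\<Sum>i=1..m. of_bool (rejects \<alpha> q i) * \<psi> i (history \<alpha> q (i - 1)) - \<phi> i (history \<alpha> q (i - 1)))"
  by (induction m) (auto simp: take_history nth_history algebra_simps)

text \<open>
  The price \<open>\<phi>\<close> of a test never exceeds the current potential, and the payout \<open>\<psi>\<close> is nonnegative.
\<close>

lemma potential_history_nonneg:
  assumes "gai_rule w0 b0 \<alpha> \<phi> \<psi>"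
  shows "0 \<le> potential w0 \<phi> \<psi> n (history \<alpha> q n)"
proof (cases n)
  case 0
  then show ?thesis using assms by (simp add: gai_rule_def)
next
  case (Suc m)
  have "\<phi> (Suc m) (history \<alpha> q m) \<le> potential w0 \<phi> \<psi> m (history \<alpha> q m)"
    and "0 \<le> \<psi> (Suc m) (history \<alpha> q m)"
    using assms unfolding gai_rule_def by (metis diff_Suc_1 le_add1 length_history plus_1_eq_Suc)+
  moreover have "potential w0 \<phi> \<psi> m (history \<alpha> q n) = potential w0 \<phi> \<psi> m (history \<alpha> q m)"
    using Suc by (simp only: potential_history order_refl le_SucI)
  ultimately show ?thesis
    using Suc by (simp add: take_history del: history.simps)
qed

section \<open>Expectations of functions of the history\<close>

lemma measurable_history:
  assumes "\<And>i. i \<in> {1..n} \<Longrightarrow> (\<lambda>\<omega>. q \<omega> i) \<in> borel_measurable M"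
  shows "(\<lambda>\<omega>. history \<alpha> (q \<omega>) n) \<in> measurable M (count_space UNIV)"
  using assms
proof (induction n)
  case (Suc n)
  have [measurable]: "(\<lambda>\<omega>. q \<omega> (Suc n)) \<in> borel_measurable M" using Suc.prems by auto
  have "(\<lambda>\<omega>. history \<alpha> (q \<omega>) n @ [q \<omega> (Suc n) \<le> \<alpha> (Suc n) (history \<alpha> (q \<omega>) n)])
          \<in> measurable M (count_space UNIV)"
  proof (rule measurable_compose_countable[where f = "\<lambda>x \<omega>. x @ [q \<omega> (Suc n) \<le> \<alpha> (Suc n) x]"])
    show "(\<lambda>\<omega>. x @ [q \<omega> (Suc n) \<le> \<alpha> (Suc n) x]) \<in> measurable M (count_space UNIV)" for x
      by measurable
    show "(\<lambda>\<omega>. history \<alpha> (q \<omega>) n) \<in> measurable M (count_space UNIV)"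
      using Suc by auto
  qed
  then show ?case by simp
qed simp

lemma finite_bool_lists: "finite {x :: bool list. length x = n}"
  using finite_lists_length_eq[of "UNIV :: bool set" n] by simp

context prob_space
begin

lemma integrable_fun_of_history:
  fixes g :: "bool list \<Rightarrow> real"
  assumes "\<And>i. i \<in> {1..n} \<Longrightarrow> (\<lambda>\<omega>. q \<omega> i) \<in> borel_measurable M"
  shows "integrable M (\<lambda>\<omega>. g (history \<alpha> (q \<omega>) n))"
proof (rule integrable_const_bound)
  show "AE \<omega> in M. norm (g (history \<alpha> (q \<omega>) n)) \<le> Max ((\<lambda>x. norm (g x)) ` {x. length x = n})"
    by (intro AE_I2 Max_ge finite_imageI finite_bool_lists imageI) simp
  show "(\<lambda>\<omega>. g (history \<alpha> (q \<omega>) n)) \<in> borel_measurable M"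
    by (rule measurable_compose[OF measurable_history[OF assms]]) auto
qed

text \<open>
  The finite form of the conditioning argument: conditionally on \<open>G\<close>, the variable \<open>U\<close> falls below a
  threshold determined by \<open>G\<close> with probability at most that threshold, so the event may be replaced
  by the threshold in expectations against nonnegative weights depending on \<open>G\<close>.
\<close>

lemma expectation_threshold_le:
  fixes F a :: "'b \<Rightarrow> real" and U :: "'a \<Rightarrow> real"
  assumes fin: "finite S" and G: "\<And>\<omega>. \<omega> \<in> space M \<Longrightarrow> G \<omega> \<in> S"
    and G_meas: "G \<in> measurable M (count_space UNIV)" and U [measurable]: "U \<in> borel_measurable M"
    and F: "\<And>x. x \<in> S \<Longrightarrow> 0 \<le> F x"
    and le: "\<And>x. x \<in> S \<Longrightarrow> \<P>(\<omega> in M. G \<omega> = x \<and> U \<omega> \<le> a x) \<le> a x * \<P>(\<omega> in M. G \<omega> = x)"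
  shows "(\<integral>\<omega>. of_bool (U \<omega> \<le> a (G \<omega>)) * F (G \<omega>) \<partial>M) \<le> (\<integral>\<omega>. a (G \<omega>) * F (G \<omega>) \<partial>M)"
proof -
  define A where "A x = {\<omega> \<in> space M. G \<omega> = x \<and> U \<omega> \<le> a x}" for x
  define E where "E x = {\<omega> \<in> space M. G \<omega> = x}" for x
  have [measurable]: "Measurable.pred M (\<lambda>\<omega>. G \<omega> = x)" for x
    using measurable_compose[OF G_meas, of "\<lambda>y. y = x" "count_space UNIV"] by simp
  have A: "A x \<in> events" and E: "E x \<in> events" for x
    unfolding A_def E_def by measurable
  have int: "integrable M (\<lambda>\<omega>. c * indicator B \<omega>)"
    and expectation: "(\<integral>\<omega>. c * indicator B \<omega> \<partial>M) = c * prob B" if "B \<in> events" for B and c :: real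
    using that sets.sets_into_space[OF that] by (auto simp: emeasure_eq_measure Int_absorb2)
  have "(\<integral>\<omega>. of_bool (U \<omega> \<le> a (G \<omega>)) * F (G \<omega>) \<partial>M)
      = (\<integral>\<omega>. (\<Sum>x\<in>S. F x * indicator (A x) \<omega>) \<partial>M)"
  proof (rule Bochner_Integration.integral_cong)
    fix \<omega> assume \<omega>: "\<omega> \<in> space M"
    then have "(\<Sum>x\<in>S. F x * indicator (A x) \<omega>)
        = (\<Sum>x\<in>S. if x = G \<omega> then of_bool (U \<omega> \<le> a x) * F x else 0)"
      by (intro sum.cong) (auto simp: A_def indicator_def)
    then show "of_bool (U \<omega> \<le> a (G \<omega>)) * F (G \<omega>) = (\<Sum>x\<in>S. F x * indicator (A x) \<omega>)"
      using fin G[OF \<omega>] by simp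
  qed simp
  also have "\<dots> = (\<Sum>x\<in>S. F x * prob (A x))"
    by (simp only: Bochner_Integration.integral_sum int expectation A)
  also have "\<dots> \<le> (\<Sum>x\<in>S. F x * (a x * prob (E x)))"
    unfolding A_def E_def by (intro sum_mono mult_left_mono le F)
  also have "\<dots> = (\<Sum>x\<in>S. (a x * F x) * prob (E x))"
    by (simp add: ac_simps)
  also have "\<dots> = (\<integral>\<omega>. (\<Sum>x\<in>S. (a x * F x) * indicator (E x) \<omega>) \<partial>M)"
    by (simp only: Bochner_Integration.integral_sum int expectation E)
  also have "\<dots> = (\<integral>\<omega>. a (G \<omega>) * F (G \<omega>) \<partial>M)"
  proof (rule Bochner_Integration.integral_cong)
    fix \<omega> assume \<omega>: "\<omega> \<in> space M"
    then have "(\<Sum>x\<in>S. (a x * F x) * indicator (E x) \<omega>) = (\<Sum>x\<in>S. if x = G \<omega> then a x * F x else 0)"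
      by (intro sum.cong) (auto simp: E_def indicator_def)
    then show "(\<Sum>x\<in>S. (a x * F x) * indicator (E x) \<omega>) = a (G \<omega>) * F (G \<omega>)"
      using fin G[OF \<omega>] by simp
  qed simp
  finally show ?thesis .
qed

text \<open>
  Only an inequality, since the level \<open>a\<close> may exceed \<open>1\<close>.
\<close>

lemma prob_uniform_le:
  assumes U [measurable]: "U \<in> borel_measurable M"
    and unif: "distr M lborel U = uniform_measure lborel {0..1}" and "0 \<le> (a :: real)"
  shows "\<P>(\<omega> in M. U \<omega> \<le> a) \<le> a"
proof -
  have "{\<omega> \<in> space M. U \<omega> \<le> a} = U -` {..a} \<inter> space M"
    by auto
  then have "\<P>(\<omega> in M. U \<omega> \<le> a) = measure (distr M lborel U) {..a}"
    by (subst measure_distr) auto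
  also have "\<dots> = measure lborel ({0..1} \<inter> {..a})"
    unfolding unif by (subst measure_uniform_measure) auto
  also have "{0..1} \<inter> {..a} = {0..min 1 a}"
    by auto
  also have "measure lborel \<dots> \<le> a"
    using assms(3) by simp
  finally show ?thesis .
qed

section \<open>Removing the dependence on a single null p-value\<close>

text \<open>
  Independence of the nulls from the non-nulls splits both sides into a null and a non-null factor;
  mutual independence of the nulls then detaches the factor of \<open>j\<close> from the null one.
\<close>

lemma prob_null_and_others:
  assumes indep: "indep_null_pvalues \<theta> M p"
    and K: "finite K" "K \<subseteq> {1..}" "j \<notin> K" and j: "1 \<le> j" "\<theta> j = 0"
    and meas: "\<And>i. 1 \<le> i \<Longrightarrow> p i \<in> borel_measurable M"
    and B: "\<And>i. B i \<in> sets borel"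
  shows "\<P>(\<omega> in M. \<forall>i\<in>insert j K. p i \<omega> \<in> B i)
       = \<P>(\<omega> in M. p j \<omega> \<in> B j) * \<P>(\<omega> in M. \<forall>i\<in>K. p i \<omega> \<in> B i)"
proof -
  define N0 where "N0 = {i. 1 \<le> i \<and> \<theta> i = 0}"
  define N1 where "N1 = {i. 1 \<le> i \<and> \<theta> i \<noteq> 0}"
  have iv: "indep_vars (\<lambda>_. borel) p N0"
    and i2: "indep_var (\<Pi>\<^sub>M i\<in>N0. borel) (\<lambda>\<omega>. \<lambda>i\<in>N0. p i \<omega>) (\<Pi>\<^sub>M i\<in>N1. borel) (\<lambda>\<omega>. \<lambda>i\<in>N1. p i \<omega>)"
    using indep unfolding indep_null_pvalues_def Let_def N0_def N1_def by auto
  have cyl: "{f \<in> space (\<Pi>\<^sub>M i\<in>N. borel). \<forall>i\<in>L \<inter> N. f i \<in> B i} \<in> sets (\<Pi>\<^sub>M i\<in>N. borel)"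
    if "finite L" for L N
    using that B by measurable
  have split: "\<P>(\<omega> in M. \<forall>i\<in>L. p i \<omega> \<in> B i)
      = \<P>(\<omega> in M. \<forall>i\<in>L \<inter> N0. p i \<omega> \<in> B i) * \<P>(\<omega> in M. \<forall>i\<in>L \<inter> N1. p i \<omega> \<in> B i)"
    if L: "finite L" "L \<subseteq> {1..}" for L
  proof -
    let ?A = "\<lambda>N. {f \<in> space (\<Pi>\<^sub>M i\<in>N. borel). \<forall>i\<in>L \<inter> N. f i \<in> B i}"
    have LN: "i \<in> N0 \<or> i \<in> N1" if "i \<in> L" for i
      using that L(2) by (auto simp: N0_def N1_def)
    have "(\<lambda>\<omega>. (\<lambda>i\<in>N0. p i \<omega>, \<lambda>i\<in>N1. p i \<omega>)) -` (?A N0 \<times> ?A N1) \<inter> space M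
        = {\<omega>\<in>space M. (\<forall>i\<in>L \<inter> N0. p i \<omega> \<in> B i) \<and> (\<forall>i\<in>L \<inter> N1. p i \<omega> \<in> B i)}"
      by (auto simp: space_PiM)
    moreover have "(\<forall>i\<in>L. p i \<omega> \<in> B i) \<longleftrightarrow>
        (\<forall>i\<in>L \<inter> N0. p i \<omega> \<in> B i) \<and> (\<forall>i\<in>L \<inter> N1. p i \<omega> \<in> B i)" for \<omega>
      using LN by blast
    moreover have "(\<lambda>\<omega>. \<lambda>i\<in>N. p i \<omega>) -` ?A N \<inter> space M = {\<omega>\<in>space M. \<forall>i\<in>L \<inter> N. p i \<omega> \<in> B i}" for N
      by (auto simp: space_PiM)
    ultimately show ?thesis
      using indep_varD[OF i2 cyl[OF L(1)] cyl[OF L(1)]] by simp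
  qed
  have null: "\<P>(\<omega> in M. \<forall>i\<in>L. p i \<omega> \<in> B i) = (\<Prod>i\<in>L. \<P>(\<omega> in M. p i \<omega> \<in> B i))"
    if L: "finite L" "L \<subseteq> N0" for L
  proof (cases "L = {}")
    case True
    then show ?thesis by (simp add: prob_space)
  next
    case False
    have "{\<omega>\<in>space M. \<forall>i\<in>L. p i \<omega> \<in> B i} = (\<Inter>i\<in>L. p i -` B i \<inter> space M)"
      using False by auto
    also have "prob \<dots> = (\<Prod>i\<in>L. prob (p i -` B i \<inter> space M))"
      by (rule indep_varsD[OF iv False L B])
    also have "\<dots> = (\<Prod>i\<in>L. \<P>(\<omega> in M. p i \<omega> \<in> B i))"
      by (intro prod.cong refl arg_cong[where f = prob]) auto
    finally show ?thesis .
  qed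
  have "insert j K \<inter> N0 = insert j (K \<inter> N0)" "insert j K \<inter> N1 = K \<inter> N1"
    using j by (auto simp: N0_def N1_def)
  then show ?thesis
    using split[of K] split[of "insert j K"] null[of "K \<inter> N0"] null[of "insert j (K \<inter> N0)"] K j
    by (simp add: N0_def)
qed


text \<open>
  The key inequality, proved by replacing \<open>p\<^sub>j\<close> with \<open>0\<close>: \<open>q0\<close> is the modified sequence, \<open>G\<close>
  its history, and \<open>a\<close> and \<open>F\<close> express the level at time \<open>j\<close> and the weight as functions of that history.
  The weight \<open>f\<close> stands for any nonnegative quantity known before the \<open>j\<close>-th test.
\<close>

lemma null_rejection_le_threshold:
  fixes p :: "nat \<Rightarrow> 'a \<Rightarrow> real" and f :: "bool list \<Rightarrow> real"
  assumes indep: "indep_null_pvalues \<theta> M p"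
    and j: "j \<in> {1..n}" "\<theta> j = 0"
    and meas: "\<And>i. 1 \<le> i \<Longrightarrow> p i \<in> borel_measurable M"
    and nonneg: "\<And>i \<omega>. 1 \<le> i \<Longrightarrow> \<omega> \<in> space M \<Longrightarrow> 0 \<le> p i \<omega>"
    and unif: "distr M lborel (p j) = uniform_measure lborel {0..1}"
    and mono: "monotone_rule \<alpha>"
    and \<alpha>: "\<And>x. length x = j - 1 \<Longrightarrow> 0 \<le> \<alpha> j x"
    and f: "\<And>x. length x = j - 1 \<Longrightarrow> 0 \<le> f x"
  defines "q \<equiv> \<lambda>\<omega> i. p i \<omega>"
  shows "(\<integral>\<omega>. of_bool (rejects \<alpha> (q \<omega>) j) * f (history \<alpha> (q \<omega>) (j - 1))
                / max (discoveries \<alpha> (q \<omega>) n) 1 \<partial>M)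
       \<le> (\<integral>\<omega>. \<alpha> j (history \<alpha> (q \<omega>) (j - 1)) * f (history \<alpha> (q \<omega>) (j - 1))
                / max (discoveries \<alpha> (q \<omega>) n) 1 \<partial>M)"
proof -
  define q0 where "q0 \<omega> = (q \<omega>)(j := 0)" for \<omega>
  define G where "G \<omega> = history \<alpha> (q0 \<omega>) n" for \<omega>
  define a where "a x = \<alpha> j (take (j - 1) x)" for x
  define F where "F x = f (take (j - 1) x) / max (card {i \<in> {1..n}. x ! (i - 1)}) 1" for x
  have q_meas: "(\<lambda>\<omega>. q \<omega> i) \<in> borel_measurable M" "(\<lambda>\<omega>. q0 \<omega> i) \<in> borel_measurable M"
    if "i \<in> {1..n}" for i
    using that meas by (auto simp: q_def q0_def fun_upd_def)
  have G_meas: "G \<in> measurable M (count_space UNIV)"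
    unfolding G_def by (rule measurable_history[OF q_meas(2)])
  have take_G: "take (j - 1) (G \<omega>) = history \<alpha> (q \<omega>) (j - 1)" for \<omega>
    using j by (auto simp: G_def q0_def take_history history_upd_before)
  have F_G: "F (G \<omega>) = f (history \<alpha> (q \<omega>) (j - 1)) / max (discoveries \<alpha> (q0 \<omega>) n) 1" for \<omega>
    unfolding F_def take_G by (simp add: G_def discoveries_history)
  have a_G: "a (G \<omega>) = \<alpha> j (history \<alpha> (q \<omega>) (j - 1))" for \<omega>
    unfolding a_def take_G ..
  have le: "\<P>(\<omega> in M. G \<omega> = x \<and> p j \<omega> \<le> a x) \<le> a x * \<P>(\<omega> in M. G \<omega> = x)"
    if x: "length x = n" for x
  proof (cases "x ! (j - 1)")
    case False
    have "0 \<le> a x"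
      using x j by (auto simp: a_def intro!: \<alpha>)
    moreover have "G \<omega> \<noteq> x" for \<omega>
      using False \<open>0 \<le> a x\<close> j by (auto simp: G_def history_eq_iff q0_def a_def intro!: bexI[of _ j])
    ultimately show ?thesis
      by simp
  next
    case True
    have a0: "0 \<le> a x"
      using x j by (auto simp: a_def intro!: \<alpha>)
    \<comment> \<open>After the replacement the decision at time \<open>j\<close> is always a rejection, so the event
      \<open>G \<omega> = x\<close> leaves the \<open>j\<close>-th coordinate free for the constraint \<open>p\<^sub>j \<le> a x\<close>.\<close>
    define B where "B i = (if i = j then {..a x}
        else {r. (r \<le> \<alpha> i (take (i - 1) x)) = x ! (i - 1)})" for i
    have B: "B i \<in> sets borel" for i
      unfolding B_def by simp
    have eq: "G \<omega> = x \<longleftrightarrow> (\<forall>i\<in>{1..n} - {j}. p i \<omega> \<in> B i)" for \<omega>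
    proof -
      have "{1..n} = insert j ({1..n} - {j})"
        using j by auto
      then have "G \<omega> = x \<longleftrightarrow> (\<forall>i\<in>insert j ({1..n} - {j}). (q0 \<omega> i \<le> \<alpha> i (take (i - 1) x)) = x ! (i - 1))"
        using x by (simp add: G_def history_eq_iff)
      then show ?thesis
        using True a0 by (auto simp: q0_def q_def a_def B_def)
    qed
    have "\<P>(\<omega> in M. G \<omega> = x \<and> p j \<omega> \<le> a x)
        = \<P>(\<omega> in M. \<forall>i\<in>insert j ({1..n} - {j}). p i \<omega> \<in> B i)"
      unfolding eq by (rule arg_cong[where f = prob]) (auto simp: B_def)
    also have "\<dots> = \<P>(\<omega> in M. p j \<omega> \<in> B j) * \<P>(\<omega> in M. \<forall>i\<in>{1..n} - {j}. p i \<omega> \<in> B i)"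
      by (rule prob_null_and_others[OF indep _ _ _ _ _ meas B]) (use j in auto)
    also have "\<P>(\<omega> in M. p j \<omega> \<in> B j) = \<P>(\<omega> in M. p j \<omega> \<le> a x)"
      by (simp add: B_def)
    also have "\<P>(\<omega> in M. p j \<omega> \<le> a x) * \<P>(\<omega> in M. \<forall>i\<in>{1..n} - {j}. p i \<omega> \<in> B i)
        \<le> a x * \<P>(\<omega> in M. \<forall>i\<in>{1..n} - {j}. p i \<omega> \<in> B i)"
      using j meas by (intro mult_right_mono prob_uniform_le unif a0) auto
    finally show ?thesis
      unfolding eq .
  qed
  have "(\<integral>\<omega>. of_bool (rejects \<alpha> (q \<omega>) j) * f (history \<alpha> (q \<omega>) (j - 1))
                / max (discoveries \<alpha> (q \<omega>) n) 1 \<partial>M)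
      = (\<integral>\<omega>. of_bool (p j \<omega> \<le> a (G \<omega>)) * F (G \<omega>) \<partial>M)"
  proof (rule Bochner_Integration.integral_cong)
    fix \<omega>
    have "rejects \<alpha> (q \<omega>) j \<longleftrightarrow> p j \<omega> \<le> a (G \<omega>)"
      by (simp add: rejects_def a_G q_def)
    moreover have "discoveries \<alpha> (q0 \<omega>) n = discoveries \<alpha> (q \<omega>) n" if "rejects \<alpha> (q \<omega>) j"
      unfolding discoveries_history q0_def by (simp add: history_upd_rejected[OF that \<alpha>])
    ultimately show "of_bool (rejects \<alpha> (q \<omega>) j) * f (history \<alpha> (q \<omega>) (j - 1))
          / max (discoveries \<alpha> (q \<omega>) n) 1 = of_bool (p j \<omega> \<le> a (G \<omega>)) * F (G \<omega>)"
      by (auto simp: F_G)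
  qed simp
  also have "\<dots> \<le> (\<integral>\<omega>. a (G \<omega>) * F (G \<omega>) \<partial>M)"
  proof (rule expectation_threshold_le[OF finite_bool_lists[of n] _ G_meas])
    show "p j \<in> borel_measurable M"
      using meas j by auto
    show "0 \<le> F x" if "x \<in> {x. length x = n}" for x
      using that j by (auto simp: F_def intro!: divide_nonneg_nonneg f)
  qed (use le in \<open>auto simp: G_def\<close>)
  also have "\<dots> \<le> (\<integral>\<omega>. \<alpha> j (history \<alpha> (q \<omega>) (j - 1)) * f (history \<alpha> (q \<omega>) (j - 1))
                / max (discoveries \<alpha> (q \<omega>) n) 1 \<partial>M)"
  proof (rule integral_mono)
    show "integrable M (\<lambda>\<omega>. a (G \<omega>) * F (G \<omega>))"
      unfolding G_def by (rule integrable_fun_of_history[OF q_meas(2)])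
    have "(\<lambda>\<omega>. \<alpha> j (history \<alpha> (q \<omega>) (j - 1)) * f (history \<alpha> (q \<omega>) (j - 1))
                / max (discoveries \<alpha> (q \<omega>) n) 1)
        = (\<lambda>\<omega>. a (history \<alpha> (q \<omega>) n) * F (history \<alpha> (q \<omega>) n))"
      using j by (auto simp: a_def F_def take_history discoveries_history)
    then show "integrable M (\<lambda>\<omega>. \<alpha> j (history \<alpha> (q \<omega>) (j - 1)) * f (history \<alpha> (q \<omega>) (j - 1))
                / max (discoveries \<alpha> (q \<omega>) n) 1)"
      using integrable_fun_of_history[OF q_meas(1), where g = "\<lambda>x. a x * F x"] by simp
  next
    fix \<omega> assume "\<omega> \<in> space M"
    then have "discoveries \<alpha> (q \<omega>) n \<le> discoveries \<alpha> (q0 \<omega>) n"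
      using nonneg by (intro discoveries_mono[OF mono]) (auto simp: q0_def q_def)
    then have "1 / real (max (discoveries \<alpha> (q0 \<omega>) n) 1) \<le> 1 / real (max (discoveries \<alpha> (q \<omega>) n) 1)"
      by (intro divide_left_mono) auto
    then have "\<alpha> j (history \<alpha> (q \<omega>) (j - 1)) * f (history \<alpha> (q \<omega>) (j - 1))
          * (1 / real (max (discoveries \<alpha> (q0 \<omega>) n) 1))
        \<le> \<alpha> j (history \<alpha> (q \<omega>) (j - 1)) * f (history \<alpha> (q \<omega>) (j - 1))
          * (1 / real (max (discoveries \<alpha> (q \<omega>) n) 1))"
      by (intro mult_left_mono mult_nonneg_nonneg \<alpha> f) auto
    then show "a (G \<omega>) * F (G \<omega>) \<le> \<alpha> j (history \<alpha> (q \<omega>) (j - 1))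
          * f (history \<alpha> (q \<omega>) (j - 1)) / max (discoveries \<alpha> (q \<omega>) n) 1"
      by (simp add: a_G F_G)
  qed
  finally show ?thesis .
qed

section \<open>The bound on the false discovery rate\<close>

text \<open>
  The increments \<open>D i\<close> add up to \<open>b0 R(n) - V(n) + w0 - W(n)\<close>.
\<close>

lemma expected_false_discovery_proportion_le:
  fixes p :: "nat \<Rightarrow> 'a \<Rightarrow> real"
  assumes indep: "indep_null_pvalues \<theta> M p"
    and meas: "\<And>i. 1 \<le> i \<Longrightarrow> p i \<in> borel_measurable M"
    and nonneg: "\<And>i \<omega>. 1 \<le> i \<Longrightarrow> \<omega> \<in> space M \<Longrightarrow> 0 \<le> p i \<omega>"
    and unif: "\<And>i. 1 \<le> i \<Longrightarrow> \<theta> i = 0 \<Longrightarrow> distr M lborel (p i) = uniform_measure lborel {0..1}"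
    and mono: "monotone_rule \<alpha>"
    and gai: "gai_rule w0 b0 \<alpha> \<phi> \<psi>"
  shows "(\<integral>\<omega>. real (false_discoveries \<alpha> \<theta> (\<lambda>i. p i \<omega>) n)
             / real (max (discoveries \<alpha> (\<lambda>i. p i \<omega>) n) 1) \<partial>M) \<le> w0 + b0"
proof -
  define q where "q \<omega> = (\<lambda>i. p i \<omega>)" for \<omega>
  define h where "h \<omega> i = history \<alpha> (q \<omega>) (i - 1)" for \<omega> i
  define r :: "'a \<Rightarrow> nat \<Rightarrow> real" where "r \<omega> i = of_bool (rejects \<alpha> (q \<omega>) i)" for \<omega> i
  define N :: "'a \<Rightarrow> real" where "N \<omega> = real (max (discoveries \<alpha> (q \<omega>) n) 1)" for \<omega>
  define D where "D i \<omega> = b0 * r \<omega> i - of_bool (\<theta> i = 0) * r \<omega> i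
      - (r \<omega> i * \<psi> i (h \<omega> i) - \<phi> i (h \<omega> i))" for i \<omega>
  have q_meas: "(\<lambda>\<omega>. q \<omega> i) \<in> borel_measurable M" if "i \<in> {1..n}" for i
    using that meas by (auto simp: q_def)
  have rule:
    "0 \<le> \<alpha> i x" "0 \<le> \<phi> i x" "0 \<le> \<psi> i x" "\<psi> i x \<le> \<phi> i x + b0"
    "\<alpha> i x \<noteq> 0 \<Longrightarrow> \<psi> i x \<le> \<phi> i x / \<alpha> i x + b0 - 1"
    if "1 \<le> i" "length x = i - 1" for i x
    using gai that unfolding gai_rule_def by blast+
  have wb: "0 \<le> w0" "0 < b0"
    using gai by (auto simp: gai_rule_def)
  have N1: "1 \<le> N \<omega>" for \<omega>
    by (simp add: N_def)
  have r_nth: "r \<omega> i = of_bool (history \<alpha> (q \<omega>) n ! (i - 1))" if "i \<in> {1..n}" for i \<omega>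
    using that by (subst nth_history) (auto simp: r_def)
  have h_take: "h \<omega> i = take (i - 1) (history \<alpha> (q \<omega>) n)" if "i \<in> {1..n}" for i \<omega>
    using that by (auto simp: h_def take_history)
  have int: "integrable M (\<lambda>\<omega>. g (r \<omega> i) (h \<omega> i) / N \<omega>)"
    if "i \<in> {1..n}" for i and g :: "real \<Rightarrow> bool list \<Rightarrow> real"
    unfolding r_nth[OF that] h_take[OF that] N_def discoveries_history
    using integrable_fun_of_history[OF q_meas, where \<alpha> = \<alpha> and g = "\<lambda>x. g (of_bool (x ! (i - 1))) (take (i - 1) x)
        / real (max (card {i \<in> {1..n}. x ! (i - 1)}) 1)"] by simp
  have int_D: "integrable M (\<lambda>\<omega>. D i \<omega> / N \<omega>)" if "i \<in> {1..n}" for i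
    using int[OF that, of "\<lambda>s x. b0 * s - of_bool (\<theta> i = 0) * s - (s * \<psi> i x - \<phi> i x)"]
    by (simp add: D_def)
  have D_nonneg: "0 \<le> (\<integral>\<omega>. D i \<omega> / N \<omega> \<partial>M)" if i: "i \<in> {1..n}" for i
  proof (cases "\<theta> i = 0")
    case False
    have "0 \<le> D i \<omega>" for \<omega>
      using rule(2,4)[of i "h \<omega> i"] False i by (auto simp: D_def r_def h_def)
    then show ?thesis
      using N1 by (intro integral_nonneg_AE AE_I2 divide_nonneg_nonneg) (auto intro: order_trans[OF zero_le_one])
  next
    case True
    \<comment> \<open>Taking \<open>f\<close> to be \<open>\<psi> + 1 - b0\<close> rather than its upper bound \<open>\<phi> / \<alpha>\<close> treats level \<open>0\<close> uniformly,
      without discarding the null set on which a p-value equals \<open>0\<close>; the positive part makes the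
      key inequality applicable.\<close>
    define f where "f x = max 0 (\<psi> i x + 1 - b0)" for x
    have f_nonneg: "0 \<le> f x" for x
      by (simp add: f_def)
    have \<alpha>f: "\<alpha> i x * f x \<le> \<phi> i x" if x: "length x = i - 1" for x
    proof (cases "\<alpha> i x = 0")
      case True
      then show ?thesis using rule(2)[of i x] x i by simp
    next
      case False
      then have pos: "0 < \<alpha> i x" using rule(1)[of i x] x i by simp
      have "f x \<le> \<phi> i x / \<alpha> i x"
        using rule(2,5)[of i x] x i pos by (auto simp: f_def)
      then show ?thesis using pos by (simp add: field_simps)
    qed
    have "(\<integral>\<omega>. r \<omega> i * f (h \<omega> i) / N \<omega> \<partial>M) \<le> (\<integral>\<omega>. \<alpha> i (h \<omega> i) * f (h \<omega> i) / N \<omega> \<partial>M)"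
      unfolding r_def h_def N_def q_def
      by (rule null_rejection_le_threshold[OF indep i True meas nonneg unif mono])
         (use i True rule(1) f_nonneg in auto)
    also have "\<dots> \<le> (\<integral>\<omega>. \<phi> i (h \<omega> i) / N \<omega> \<partial>M)"
      using int[OF i, of "\<lambda>s x. \<alpha> i x * f x"] int[OF i, of "\<lambda>s x. \<phi> i x"] N1
      by (intro integral_mono divide_right_mono \<alpha>f) (auto simp: h_def intro: order_trans[OF zero_le_one])
    finally have "0 \<le> (\<integral>\<omega>. \<phi> i (h \<omega> i) / N \<omega> - r \<omega> i * f (h \<omega> i) / N \<omega> \<partial>M)"
      using int[OF i, of "\<lambda>s x. s * f x"] int[OF i, of "\<lambda>s x. \<phi> i x"] by simp
    also have "\<dots> \<le> (\<integral>\<omega>. D i \<omega> / N \<omega> \<partial>M)"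
    proof (rule integral_mono)
      show "integrable M (\<lambda>\<omega>. \<phi> i (h \<omega> i) / N \<omega> - r \<omega> i * f (h \<omega> i) / N \<omega>)"
        using int[OF i, of "\<lambda>s x. s * f x"] int[OF i, of "\<lambda>s x. \<phi> i x"] by simp
      show "integrable M (\<lambda>\<omega>. D i \<omega> / N \<omega>)"
        by (rule int_D[OF i])
      fix \<omega>
      have "\<phi> i (h \<omega> i) - r \<omega> i * f (h \<omega> i) \<le> D i \<omega>"
        using True by (auto simp: D_def r_def f_def)
      then show "\<phi> i (h \<omega> i) / N \<omega> - r \<omega> i * f (h \<omega> i) / N \<omega> \<le> D i \<omega> / N \<omega>"
        unfolding diff_divide_distrib[symmetric] using N1[of \<omega>] by (intro divide_right_mono) auto
    qed
    finally show ?thesis .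
  qed
  have pointwise: "real (false_discoveries \<alpha> \<theta> (q \<omega>) n) / N \<omega> \<le> w0 + b0 - (\<Sum>i=1..n. D i \<omega> / N \<omega>)" for \<omega>
  proof -
    have R: "real (discoveries \<alpha> (q \<omega>) n) = (\<Sum>i=1..n. r \<omega> i)"
      by (simp add: discoveries_def r_def Int_def)
    have "of_bool (\<theta> i = 0) * r \<omega> i = of_bool (rejects \<alpha> (q \<omega>) i \<and> \<theta> i = 0)" for i
      by (auto simp: r_def)
    then have V: "real (false_discoveries \<alpha> \<theta> (q \<omega>) n) = (\<Sum>i=1..n. of_bool (\<theta> i = 0) * r \<omega> i)"
      by (simp add: false_discoveries_def sum_of_bool_eq Int_def del: of_bool_conj)
    have W: "potential w0 \<phi> \<psi> n (history \<alpha> (q \<omega>) n)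
        = w0 + (\<Sum>i=1..n. r \<omega> i * \<psi> i (h \<omega> i) - \<phi> i (h \<omega> i))"
      by (simp add: potential_history r_def h_def)
    have "(\<Sum>i=1..n. D i \<omega>) = b0 * real (discoveries \<alpha> (q \<omega>) n) - real (false_discoveries \<alpha> \<theta> (q \<omega>) n)
        - (potential w0 \<phi> \<psi> n (history \<alpha> (q \<omega>) n) - w0)"
      unfolding R V W D_def sum_subtractf sum_distrib_left by simp
    moreover have "0 \<le> potential w0 \<phi> \<psi> n (history \<alpha> (q \<omega>) n)"
      by (rule potential_history_nonneg[OF gai])
    moreover have "b0 * real (discoveries \<alpha> (q \<omega>) n) \<le> b0 * N \<omega>"
      using wb by (simp add: N_def)
    moreover have "w0 \<le> w0 * N \<omega>"
      using mult_left_mono[OF N1 wb(1)] by simp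
    ultimately have "real (false_discoveries \<alpha> \<theta> (q \<omega>) n) \<le> (w0 + b0) * N \<omega> - (\<Sum>i=1..n. D i \<omega>)"
      by (simp add: algebra_simps)
    then show ?thesis
      using N1[of \<omega>] unfolding sum_divide_distrib[symmetric]
      by (simp add: divide_le_eq left_diff_distrib)
  qed
  have "(\<integral>\<omega>. real (false_discoveries \<alpha> \<theta> (q \<omega>) n) / N \<omega> \<partial>M)
      \<le> (\<integral>\<omega>. w0 + b0 - (\<Sum>i=1..n. D i \<omega> / N \<omega>) \<partial>M)"
  proof (rule integral_mono)
    have "false_discoveries \<alpha> \<theta> (q \<omega>) n
        = card {i \<in> {1..n}. history \<alpha> (q \<omega>) n ! (i - 1) \<and> \<theta> i = 0}" for \<omega>
      unfolding false_discoveries_def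
      by (rule arg_cong[where f = card]) (auto simp: nth_history)
    then show "integrable M (\<lambda>\<omega>. real (false_discoveries \<alpha> \<theta> (q \<omega>) n) / N \<omega>)"
      using integrable_fun_of_history[OF q_meas, where \<alpha> = \<alpha> and
          g = "\<lambda>x. real (card {i \<in> {1..n}. x ! (i - 1) \<and> \<theta> i = 0})
            / real (max (card {i \<in> {1..n}. x ! (i - 1)}) 1)"]
      by (simp add: N_def discoveries_history)
    show "integrable M (\<lambda>\<omega>. w0 + b0 - (\<Sum>i=1..n. D i \<omega> / N \<omega>))"
      by (intro Bochner_Integration.integrable_diff integrable_const
            Bochner_Integration.integrable_sum int_D)
  qed (rule pointwise)
  also have "\<dots> = w0 + b0 - (\<Sum>i=1..n. \<integral>\<omega>. D i \<omega> / N \<omega> \<partial>M)"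
  proof -
    have "(\<integral>\<omega>. (\<Sum>i=1..n. D i \<omega> / N \<omega>) \<partial>M) = (\<Sum>i=1..n. \<integral>\<omega>. D i \<omega> / N \<omega> \<partial>M)"
      by (rule Bochner_Integration.integral_sum) (rule int_D)
    moreover have "integrable M (\<lambda>\<omega>. \<Sum>i=1..n. D i \<omega> / N \<omega>)"
      by (rule Bochner_Integration.integrable_sum) (rule int_D)
    ultimately show ?thesis
      by (subst Bochner_Integration.integral_diff) (auto simp: prob_space simp del: One_nat_def)
  qed
  also have "\<dots> \<le> w0 + b0"
    using sum_nonneg[of "{1..n}", OF D_nonneg] by simp
  finally show ?thesis
    by (simp add: N_def q_def)
qed

lemma indep_null_pvalues_if_indep_pvalues:
  assumes "indep_pvalues M p"
  shows "indep_null_pvalues \<theta> M p"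
  using assms unfolding indep_pvalues_def indep_null_pvalues_def Let_def
  by (auto intro: indep_vars_subset indep_var_restrict)

end

theorem theorem3p1:
  fixes \<Theta> :: "'t::zero set"
    and P :: "(nat \<Rightarrow> 't) \<Rightarrow> 'w measure"
    and p :: "nat \<Rightarrow> 'w \<Rightarrow> real"
    and w0 b0 level :: real
    and \<alpha> \<phi> \<psi> :: "nat \<Rightarrow> bool list \<Rightarrow> real"
  assumes "pvalue_model \<Theta> P p"
    and "gai_rule w0 b0 \<alpha> \<phi> \<psi>"
    and "monotone_rule \<alpha>"
    and "w0 + b0 \<le> level"
  shows "((\<forall>\<theta>\<in>params \<Theta>. indep_pvalues (P \<theta>) p) \<longrightarrow>
            (SUP n\<in>{1..}. FDR \<Theta> P p \<alpha> n) \<le> ereal level) \<and>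
         ((\<forall>\<theta>\<in>params \<Theta>. indep_null_pvalues \<theta> (P \<theta>) p) \<longrightarrow>
            (SUP n\<in>{1..}. FDR \<Theta> P p \<alpha> n) \<le> ereal level)"
proof -
  have FDR_le: "(SUP n\<in>{1..}. FDR \<Theta> P p \<alpha> n) \<le> ereal level"
    if indep: "\<forall>\<theta>\<in>params \<Theta>. indep_null_pvalues \<theta> (P \<theta>) p"
    unfolding FDR_def
  proof (intro SUP_least)
    fix n \<theta> assume \<theta>: "\<theta> \<in> params \<Theta>"
    have "prob_space (P \<theta>)"
      and "\<And>i. 1 \<le> i \<Longrightarrow> p i \<in> borel_measurable (P \<theta>)"
      and "\<And>i \<omega>. 1 \<le> i \<Longrightarrow> \<omega> \<in> space (P \<theta>) \<Longrightarrow> 0 \<le> p i \<omega>"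
      and "\<And>i. 1 \<le> i \<Longrightarrow> \<theta> i = 0 \<Longrightarrow> distr (P \<theta>) lborel (p i) = uniform_measure lborel {0..1}"
      using assms(1) \<theta> unfolding pvalue_model_def by auto
    from prob_space.expected_false_discovery_proportion_le[OF this(1) bspec[OF indep \<theta>] this(2-4) assms(3,2)]
    show "ereal (\<integral>\<omega>. real (false_discoveries \<alpha> \<theta> (\<lambda>i. p i \<omega>) n)
        / real (max (discoveries \<alpha> (\<lambda>i. p i \<omega>) n) 1) \<partial>(P \<theta>)) \<le> ereal level"
      using assms(4) by (meson ereal_less_eq(3) order_trans)
  qed
  moreover have "\<forall>\<theta>\<in>params \<Theta>. indep_null_pvalues \<theta> (P \<theta>) p"
    if "\<forall>\<theta>\<in>params \<Theta>. indep_pvalues (P \<theta>) p"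
    using that assms(1) prob_space.indep_null_pvalues_if_indep_pvalues
    unfolding pvalue_model_def by blast
  ultimately show ?thesis
    by blast
qed

end
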